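(* Fix an integer $k\ge 4$ and an integer $j$ with $1\le j\le k$. For every integer $n\ge 0$, the number of partitions of $n$ satisfying condition (P) equals the number of partitions of $n$ satisfying condition (S), where: (P) every part is $\not\equiv j\pmod k$. (S) Put $d=\lceil k/2\rceil$, and let $\lambda^{+}$ be the partition with $d-1$ fictitious parts equal to $0$ appended. Whenever $d$ consecutive entries $\lambda^+_i\ge\lambda^+_{i+1}\ge\dots\ge\lambda^+_{i+d-1}$ of $\lambda^{+}$ satisfy $\lambda^+_i-\lambda^+_{i+d-1}<2$ (that is, the difference at distance $d-1$ is strictly less than $2$), the sum of these $d$ entries satisfies $\lambda^+_i+\dots+\lambda^+_{i+d-1}\not\equiv j\pmod k$. Moreover, the generating function of the partitions satisfying (P) is the periodic infinite product $\prod_m(1-q^m)^{-1}$ over all $m\ge1$ with $m\not\equiv j\pmod k$.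
   Context: Partitions $\lambda=(\lambda_1\ge\lambda_2\ge\dots\ge\lambda_r)$ have positive integer parts. Appending $d-1$ fictitious zeros to $\lambda$ means forming the sequence $\lambda^+=(\lambda_1,\dots,\lambda_r,0,\dots,0)$ with exactly $d-1$ zeros at the end; the zeros encode the initial conditions on $\lambda$ and do not change its weight $n$. *)

theory Defs
  imports
    "HOL-Analysis.Analysis"
    "HOL-Computational_Algebra.Formal_Power_Series"
    "HOL-Number_Theory.Cong"
begin

definition partitions_of :: "nat \<Rightarrow> nat list set" where
  "partitions_of n =
     {xs. sorted_wrt (\<ge>) xs \<and> (\<forall>x\<in>set xs. x > 0) \<and> sum_list xs = n}"

lemma finite_partitions_of: "finite (partitions_of n)"
proof (rule finite_subset)
  have len: "length xs \<le> sum_list xs" if "\<forall>x\<in>set xs. x > 0" for xs :: "nat list"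
    using that by (induction xs) auto
  show "partitions_of n \<subseteq> {xs. set xs \<subseteq> {..n} \<and> length xs \<le> n}"
    by (auto simp: partitions_of_def len member_le_sum_list)
  show "finite {xs. set xs \<subseteq> {..n} \<and> length xs \<le> n}"
    by (rule finite_lists_length_le) simp
qed

definition cond_P :: "nat \<Rightarrow> nat \<Rightarrow> nat list \<Rightarrow> bool" where
  "cond_P k j xs \<longleftrightarrow> (\<forall>x\<in>set xs. \<not> [x = j] (mod k))"

definition with_zeros :: "nat \<Rightarrow> nat list \<Rightarrow> nat list" where
  "with_zeros d xs = xs @ replicate (d - 1) 0"

text \<open>Entries are indexed from \<open>0\<close>; the difference is taken in the integers, so that
  it is not truncated.\<close>

definition cond_S :: "nat \<Rightarrow> nat \<Rightarrow> nat list \<Rightarrow> bool" where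
  "cond_S k j xs \<longleftrightarrow>
     (let d = nat \<lceil>real k / 2\<rceil>; ys = with_zeros d xs in
        \<forall>i. i + d \<le> length ys \<longrightarrow>
          int (ys ! i) - int (ys ! (i + d - 1)) < 2 \<longrightarrow>
          \<not> [(\<Sum>m<d. ys ! (i + m)) = j] (mod k))"

definition gen_fun :: "(nat list \<Rightarrow> bool) \<Rightarrow> rat fps" where
  "gen_fun C = Abs_fps (\<lambda>n. of_nat (card {xs \<in> partitions_of n. C xs}))"

end

theory Submission
  imports Defs
begin

text \<open>
  A window of \<open>d\<close> consecutive entries whose extreme entries differ by at most \<open>1\<close> consists of
  copies of \<open>m\<close> and \<open>m + 1\<close> for some \<open>m\<close>, and Euclidean division of its sum \<open>N\<close> by \<open>d\<close> recovers it:
  there are \<open>N mod d\<close> copies of \<open>N div d + 1\<close> and \<open>d - N mod d\<close> copies of \<open>N div d\<close>. Condition (S)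
  therefore says that the multiset of parts contains none of the specific multisets
  \<^term>\<open>window_block d N\<close> for positive \<open>N \<equiv> j\<close> modulo \<open>k\<close>, where the block of \<open>N\<close> has sum \<open>N\<close>
  (\<open>cond_S_iff\<close>). The fictitious zeros are exactly what makes this true for \<open>N < d\<close> as well: a
  window may be completed with up to \<open>d - 1\<close> zeros, so its block consists of \<open>N\<close> ones.

  Two consecutive values of \<open>N\<close> differ by \<open>k \<ge> 2 d - 1\<close>, which is just enough for their blocks to
  have no part in common (\<open>disjoint_window_blocks\<close>). In the language of monomials, the excluded
  blocks are pairwise coprime, so the generating function of the partitions that avoid them
  depends only on their weights \<open>N\<close>. It is the same for the blocks \<open>{#N#}\<close> of the same
  weights, and avoiding those is condition (P).

  The independence of the shape of the blocks is \<open>gf_avoid_blocks\<close>. Every partition splits uniquely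
  into a union of blocks, repetitions allowed, and a partition that avoids all blocks; hence the generating
  function of all partitions is the product of the generating function of the multisets of block
  indices, weighted by their sum, and that of the avoiding partitions. The first factor depends
  only on the index set and can be cancelled.

  The product formula holds for any set \<open>A\<close> of allowed parts (\<open>mset_gf_has_prod\<close>): the partial
  products count the partitions into bounded parts from \<open>A\<close>, and in low degrees the bound excludes
  nothing.
\<close>

section \<open>Partitions as multisets\<close>

definition mset_partitions_of :: "nat \<Rightarrow> nat multiset set" where
  "mset_partitions_of n = {M. 0 \<notin># M \<and> sum_mset M = n}"

definition mset_gf :: "(nat multiset \<Rightarrow> bool) \<Rightarrow> rat fps" where
  "mset_gf C = Abs_fps (\<lambda>n. of_nat (card {M \<in> mset_partitions_of n. C M}))"

lemma decreasing_eqI: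
  fixes xs ys :: "'a :: linorder list"
  assumes "sorted_wrt (\<ge>) xs" "sorted_wrt (\<ge>) ys" "mset xs = mset ys"
  shows "xs = ys"
proof -
  have "sorted (rev xs)" "sorted (rev ys)"
    using assms by (simp_all add: sorted_wrt_rev)
  then have "rev xs = rev ys"
    using assms(3) properties_for_sort[of "rev xs" "rev ys"] sorted_sort_id by fastforce
  then show ?thesis by simp
qed

lemma image_mset_partitions:
  "mset ` {xs \<in> partitions_of n. C (mset xs)} = {M \<in> mset_partitions_of n. C M}"
proof (intro equalityI subsetI)
  fix M assume M: "M \<in> {M \<in> mset_partitions_of n. C M}"
  define xs where "xs = rev (sorted_list_of_multiset M)"
  have "mset xs = M" by (simp add: xs_def)
  moreover have "sorted_wrt (\<ge>) xs"
    by (simp add: xs_def sorted_wrt_rev)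
  ultimately have "xs \<in> {xs \<in> partitions_of n. C (mset xs)}"
    using M by (auto simp: partitions_of_def mset_partitions_of_def simp flip: sum_mset_sum_list
        intro!: gr0I)
  with \<open>mset xs = M\<close> show "M \<in> mset ` {xs \<in> partitions_of n. C (mset xs)}" by blast
qed (auto simp: partitions_of_def mset_partitions_of_def sum_mset_sum_list)

lemma card_partitions_conv_mset_gf:
  "of_nat (card {xs \<in> partitions_of n. C (mset xs)}) = fps_nth (mset_gf C) n"
proof -
  have "inj_on mset {xs \<in> partitions_of n. C (mset xs)}"
    by (auto simp: inj_on_def partitions_of_def intro: decreasing_eqI)
  from card_image[OF this] show ?thesis by (simp add: image_mset_partitions mset_gf_def)
qed

lemma finite_mset_partitions_of: "finite (mset_partitions_of n)"
  using image_mset_partitions[of n "\<lambda>_. True"] finite_partitions_of[of n]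
  by (metis (no_types, lifting) Collect_mem_eq Collect_cong finite_imageI)

lemma mset_partitions_of_0: "mset_partitions_of 0 = {{#}}"
proof -
  have "M = {#}" if "0 \<notin># M" "sum_mset M = 0" for M :: "nat multiset"
    using that by (cases M) auto
  then show ?thesis by (auto simp: mset_partitions_of_def)
qed

lemma mset_gf_nonzero: "C {#} \<Longrightarrow> mset_gf C \<noteq> 0"
proof -
  assume "C {#}"
  then have "{M \<in> mset_partitions_of 0. C M} = {{#}}" by (auto simp: mset_partitions_of_0)
  then have "fps_nth (mset_gf C) 0 = 1" by (simp add: mset_gf_def)
  then show ?thesis by auto
qed

section \<open>Avoiding pairwise disjoint blocks\<close>

text \<open>
  The index of a block is its weight, so that a multiset \<open>K\<close> of indices and the union of the blocks
  that it lists are partitions of the same number.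
\<close>

locale disjoint_blocks =
  fixes I :: "nat set" and B :: "nat \<Rightarrow> nat multiset"
  assumes pos: "N \<in> I \<Longrightarrow> 0 < N"
    and block_pos: "N \<in> I \<Longrightarrow> 0 \<notin># B N"
    and sum_block: "N \<in> I \<Longrightarrow> sum_mset (B N) = N"
    and disjoint: "N \<in> I \<Longrightarrow> N' \<in> I \<Longrightarrow> N \<noteq> N' \<Longrightarrow> set_mset (B N) \<inter> set_mset (B N') = {}"
begin

definition avoids :: "nat multiset \<Rightarrow> bool" where
  "avoids R \<longleftrightarrow> (\<forall>N\<in>I. \<not> B N \<subseteq># R)"

abbreviation union_blocks :: "nat multiset \<Rightarrow> nat multiset" where
  "union_blocks K \<equiv> \<Sum>\<^sub># (image_mset B K)"

lemma sum_union_blocks: "set_mset K \<subseteq> I \<Longrightarrow> sum_mset (union_blocks K) = sum_mset K"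
  by (induction K) (auto simp: sum_block)

lemma union_blocks_pos: "set_mset K \<subseteq> I \<Longrightarrow> 0 \<notin># union_blocks K"
  by (induction K) (auto simp: block_pos)

lemma block_nonempty: "N \<in> I \<Longrightarrow> B N \<noteq> {#}"
  using sum_block pos by force

text \<open>
  This is where disjointness enters: the other blocks contribute nothing to the multiplicities of
  the parts of \<open>B N\<close>, so a block that is not listed in \<open>K\<close> would have to lie inside \<open>R\<close>.
\<close>

lemma block_in_unionD:
  assumes "avoids R" "set_mset K \<subseteq> I" "N \<in> I" "B N \<subseteq># R + union_blocks K"
  shows "N \<in># K"
proof (rule ccontr)
  assume N: "N \<notin># K"
  have "count (B N) x \<le> count R x" for x
  proof (cases "x \<in># B N")
    case True
    have "x \<notin># B N'" if "N' \<in># K" for N'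
      using disjoint[of N N'] that True N assms(2,3) by auto
    then have "count (union_blocks K) x = 0"
      by (auto simp: count_eq_zero_iff)
    then show ?thesis
      using mset_subset_eq_count[OF assms(4), of x] by simp
  qed (simp add: not_in_iff)
  then have "B N \<subseteq># R" by (rule mset_subset_eqI)
  with assms show False by (auto simp: avoids_def)
qed

lemma decomposition_unique:
  assumes "avoids R" "avoids R'" "set_mset K \<subseteq> I" "set_mset K' \<subseteq> I"
    and "R + union_blocks K = R' + union_blocks K'"
  shows "K = K' \<and> R = R'"
  using assms(3-5)
proof (induction K arbitrary: K')
  case empty
  have "N \<notin># K'" for N
  proof
    assume N: "N \<in># K'"
    then have "B N \<subseteq># R + union_blocks {#}"
      using empty.prems(3) by (metis mset_subset_eq_add_right subset_mset.order_trans
          sum_mset.remove image_mset_add_mset multi_member_split mset_subset_eq_add_left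
          sum_mset.add_mset)
    with N show False
      using block_in_unionD[OF assms(1), of "{#}" N] empty.prems by auto
  qed
  then have "K' = {#}" by (simp add: multiset_eq_iff count_eq_zero_iff)
  with empty.prems show ?case by auto
next
  case (add N K)
  have "R' + union_blocks K' = B N + (R + union_blocks K)"
    using add.prems(3) by (simp add: ac_simps)
  then have "B N \<subseteq># R' + union_blocks K'" by simp
  then have "N \<in># K'"
    using block_in_unionD[OF assms(2), of K' N] add.prems by auto
  then obtain K'' where K'': "K' = add_mset N K''" by (meson multi_member_split)
  with add.prems add.IH[of K''] show ?case by auto
qed

lemma decomposition_exists:
  assumes "0 \<notin># M"
  shows "\<exists>K R. set_mset K \<subseteq> I \<and> avoids R \<and> M = R + union_blocks K"
  using assms
proof (induction "size M" arbitrary: M rule: less_induct)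
  case less
  show ?case
  proof (cases "avoids M")
    case True
    then show ?thesis by (intro exI[of _ "{#}"] exI[of _ M]) auto
  next
    case False
    then obtain N where N: "N \<in> I" "B N \<subseteq># M" by (auto simp: avoids_def)
    then obtain M' where M': "M = B N + M'" by (auto simp: mset_subset_eq_exists_conv)
    have "size M' < size M" using block_nonempty[OF N(1)] M' by (simp add: nonempty_has_size)
    then obtain K R where "set_mset K \<subseteq> I" "avoids R" "M' = R + union_blocks K"
      using less.hyps[of M'] less.prems M' by auto
    then show ?thesis using M' N
      by (intro exI[of _ "add_mset N K"] exI[of _ R]) auto
  qed
qed

text \<open>
  Decomposing a partition preserves weight, so its existence and uniqueness amount to a
  factorization of generating functions.
\<close>

lemma gf_factorization:
  "mset_gf (\<lambda>_. True) = mset_gf (\<lambda>K. set_mset K \<subseteq> I) * mset_gf avoids"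
proof (rule fps_ext)
  fix n
  define X where "X i = {K \<in> mset_partitions_of i. set_mset K \<subseteq> I}" for i
  define Y where "Y i = {R \<in> mset_partitions_of i. avoids R}" for i
  define g where "g = (\<lambda>(i::nat, K, R). R + union_blocks K)"
  have fin: "finite (X i)" "finite (Y i)" for i
    by (simp_all add: X_def Y_def finite_mset_partitions_of)
  have "bij_betw g (SIGMA i:{0..n}. X i \<times> Y (n - i)) (mset_partitions_of n)"
  proof (rule bij_betw_imageI)
    show "inj_on g (SIGMA i:{0..n}. X i \<times> Y (n - i))"
      by (rule inj_onI)
        (auto simp: g_def X_def Y_def mset_partitions_of_def dest: decomposition_unique)
    show "g ` (SIGMA i:{0..n}. X i \<times> Y (n - i)) = mset_partitions_of n"
    proof (intro equalityI subsetI)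
      fix M assume M: "M \<in> mset_partitions_of n"
      then obtain K R where KR: "set_mset K \<subseteq> I" "avoids R" "M = R + union_blocks K"
        using decomposition_exists[of M] by (auto simp: mset_partitions_of_def)
      with M have "(sum_mset K, K, R) \<in> (SIGMA i:{0..n}. X i \<times> Y (n - i))"
        using pos by (auto simp: X_def Y_def mset_partitions_of_def sum_union_blocks)
      then show "M \<in> g ` (SIGMA i:{0..n}. X i \<times> Y (n - i))"
        using KR(3) by (force simp: g_def)
    qed (auto simp: g_def X_def Y_def mset_partitions_of_def sum_union_blocks
        dest: union_blocks_pos)
  qed
  then have "card (mset_partitions_of n) = (\<Sum>i=0..n. card (X i) * card (Y (n - i)))"
    using fin by (simp add: bij_betw_same_card[symmetric] card_cartesian_product)
  then show "fps_nth (mset_gf (\<lambda>_. True)) n =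
      fps_nth (mset_gf (\<lambda>K. set_mset K \<subseteq> I) * mset_gf avoids) n"
    by (simp add: fps_mult_nth mset_gf_def X_def Y_def)
qed

end

text \<open>
  The family \<open>{#N#}\<close> is itself a family of disjoint blocks with the same index set, so both
  avoidance problems are complementary factors of the same power series with the same cofactor.
\<close>

theorem gf_avoid_blocks:
  assumes "disjoint_blocks I B"
  shows "mset_gf (\<lambda>R. \<forall>N\<in>I. \<not> B N \<subseteq># R) = mset_gf (\<lambda>R. \<forall>N\<in>I. N \<notin># R)"
proof -
  interpret blocks: disjoint_blocks I B by fact
  interpret parts: disjoint_blocks I "\<lambda>N. {#N#}"
    by unfold_locales (auto dest: blocks.pos)
  have "mset_gf (\<lambda>K. set_mset K \<subseteq> I) \<noteq> 0" by (rule mset_gf_nonzero) simp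
  moreover have "mset_gf (\<lambda>K. set_mset K \<subseteq> I) * mset_gf blocks.avoids =
      mset_gf (\<lambda>K. set_mset K \<subseteq> I) * mset_gf parts.avoids"
    by (metis blocks.gf_factorization parts.gf_factorization)
  ultimately have "mset_gf blocks.avoids = mset_gf parts.avoids"
    using mult_left_cancel by blast
  then show ?thesis
    by (simp add: blocks.avoids_def[abs_def] parts.avoids_def[abs_def])
qed

section \<open>Balanced windows\<close>

definition balanced :: "nat \<Rightarrow> nat \<Rightarrow> nat multiset" where
  "balanced d N = replicate_mset (d - N mod d) (N div d) + replicate_mset (N mod d) (Suc (N div d))"

lemma balanced_unique:
  assumes "0 < d" "size W = d" "m \<in># W" "\<And>x. x \<in># W \<Longrightarrow> x = m \<or> x = Suc m"
  shows "W = balanced d (sum_mset W)"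
proof -
  define c where "c = count W (Suc m)"
  have W: "W = replicate_mset (count W m) m + replicate_mset c (Suc m)"
  proof (rule multiset_eqI)
    fix x
    have "count W x = 0" if "x \<noteq> m" "x \<noteq> Suc m"
      using assms(4)[of x] that by (meson not_in_iff)
    then show "count W x = count (replicate_mset (count W m) m + replicate_mset c (Suc m)) x"
      by (auto simp: c_def)
  qed
  have "d = count W m + c"
    using arg_cong[OF W, of size] assms(2) by simp
  moreover have "count W m > 0" using assms(3) by simp
  ultimately have c: "c < d" "count W m = d - c" by auto
  have "sum_mset W = count W m * m + c * Suc m"
    using arg_cong[OF W, of sum_mset] by simp
  also have "\<dots> = m * d + c" unfolding c(2) using c(1) by (simp add: algebra_simps diff_mult_distrib2)
  finally have "sum_mset W div d = m" "sum_mset W mod d = c" using c(1) by auto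
  then show ?thesis using W c(2) by (simp add: balanced_def)
qed

lemma sum_balanced: "0 < d \<Longrightarrow> sum_mset (balanced d N) = N"
proof -
  assume d: "0 < d"
  have "sum_mset (balanced d N) = (d - N mod d) * (N div d) + N mod d * (N div d) + N mod d"
    by (simp add: balanced_def algebra_simps)
  also have "\<dots> = d * (N div d) + N mod d"
    using d by (simp flip: add_mult_distrib)
  finally show ?thesis by simp
qed

lemma set_balanced:
  "x \<in># balanced d N \<Longrightarrow> x = N div d \<or> x = Suc (N div d) \<and> N mod d \<noteq> 0"
  by (auto simp: balanced_def split: if_splits)

text \<open>
  In a weakly decreasing list the entries of a given value form a run, and the runs of \<open>m + 1\<close> and
  \<open>m\<close> are adjacent. Containing a balanced multiset is therefore the same as having it as a window;
  the next two lemmas are the two directions.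
\<close>

lemma window_imp_balanced:
  assumes ys: "sorted_wrt (\<ge>) ys" and d: "0 < d" and i: "i + d \<le> length ys"
    and diff: "int (ys ! i) - int (ys ! (i + d - 1)) < 2"
  shows "balanced d (\<Sum>m<d. ys ! (i + m)) \<subseteq># mset ys"
proof -
  define W where "W = mset (take d (drop i ys))"
  have len: "length (take d (drop i ys)) = d" using i by simp
  have nth: "take d (drop i ys) ! t = ys ! (i + t)" if "t < d" for t
    using that i by simp
  have ord: "ys ! b \<le> ys ! a" if "a \<le> b" "b < length ys" for a b
    using ys that by (cases "a = b") (auto simp: sorted_wrt_iff_nth_less)
  define m where "m = ys ! (i + d - 1)"
  have "x = m \<or> x = Suc m" if "x \<in># W" for x
  proof -
    from that obtain t where t: "t < d" "x = ys ! (i + t)"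
      unfolding W_def using len nth by (metis in_set_conv_nth set_mset_mset)
    have "m \<le> x" "x \<le> ys ! i"
      using t i ord[of "i + t" "i + d - 1"] ord[of i "i + t"] by (auto simp: m_def)
    then show ?thesis using diff unfolding m_def by linarith
  qed
  moreover have "m \<in># W"
    unfolding W_def m_def using len nth[of "d - 1"] d
    by (metis Nat.add_diff_assoc One_nat_def Suc_leI diff_less nth_mem set_mset_mset zero_less_one)
  ultimately have "W = balanced d (sum_mset W)"
    using d len by (intro balanced_unique) (auto simp: W_def)
  moreover have "sum_mset W = (\<Sum>m<d. ys ! (i + m))"
    unfolding W_def sum_mset_sum_list sum_list_sum_nth len atLeast0LessThan
    by (auto simp only: nth lessThan_iff intro!: sum.cong)
  moreover have "W \<subseteq># mset ys"
    unfolding W_def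
    by (metis append_take_drop_id mset_append mset_subset_eq_add_left mset_subset_eq_add_right
        subset_mset.order_trans)
  ultimately show ?thesis by simp
qed

lemma balanced_imp_window:
  assumes ys: "sorted_wrt (\<ge>) ys" and d: "0 < d" and sub: "balanced d N \<subseteq># mset ys"
  obtains i where "i + d \<le> length ys" "int (ys ! i) - int (ys ! (i + d - 1)) < 2"
    "(\<Sum>m<d. ys ! (i + m)) = N"
proof -
  define m where "m = N div d"
  define a where "a = N mod d"
  define c0 where "c0 = count (mset ys) m"
  define c1 where "c1 = count (mset ys) (Suc m)"
  have a: "a < d" using d by (simp add: a_def)
  have c: "d - a \<le> c0" "a \<le> c1"
    using mset_subset_eq_count[OF sub, of m] mset_subset_eq_count[OF sub, of "Suc m"]
    by (auto simp: balanced_def m_def a_def c0_def c1_def)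
  have "ys = filter (\<lambda>x. Suc m < x) ys @ replicate c1 (Suc m) @ replicate c0 m
      @ filter (\<lambda>x. x < m) ys"
  proof (rule decreasing_eqI[OF ys])
    show "mset ys = mset (filter (\<lambda>x. Suc m < x) ys @ replicate c1 (Suc m) @ replicate c0 m
        @ filter (\<lambda>x. x < m) ys)"
    proof (rule multiset_eqI)
      fix x
      consider "x < m" | "x = m" | "x = Suc m" | "Suc m < x" by linarith
      then show "count (mset ys) x = count (mset (filter (\<lambda>x. Suc m < x) ys @
          replicate c1 (Suc m) @ replicate c0 m @ filter (\<lambda>x. x < m) ys)) x"
        by cases (auto simp: c0_def c1_def)
    qed
    show "sorted_wrt (\<ge>) (filter (\<lambda>x. Suc m < x) ys @ replicate c1 (Suc m) @ replicate c0 m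
        @ filter (\<lambda>x. x < m) ys)"
      using ys by (auto simp: sorted_wrt_append sorted_wrt_filter sorted_wrt_iff_nth_less[of _ "replicate _ _"])
  qed
  \<comment> \<open>The window takes the last \<open>a\<close> copies of \<open>m + 1\<close> and the first \<open>d - a\<close> copies of \<open>m\<close>.\<close>
  moreover define P where "P = filter (\<lambda>x. Suc m < x) ys @ replicate (c1 - a) (Suc m)"
  moreover define W where "W = replicate a (Suc m) @ replicate (d - a) m"
  moreover define Q where "Q = replicate (c0 - (d - a)) m @ filter (\<lambda>x. x < m) ys"
  moreover have "replicate c1 (Suc m) = replicate (c1 - a) (Suc m) @ replicate a (Suc m)"
    "replicate c0 m = replicate (d - a) m @ replicate (c0 - (d - a)) m"
    using c by (simp_all flip: replicate_add)
  ultimately have split: "ys = P @ W @ Q" by simp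
  have len: "length W = d" using a by (simp add: W_def)
  have nth: "ys ! (length P + t) = W ! t" if "t < d" for t
    using that len by (simp add: split nth_append)
  have mem: "x = m \<or> x = Suc m" if "x \<in> set W" for x
    using that by (auto simp: W_def)
  show thesis
  proof (rule that[of "length P"])
    show "length P + d \<le> length ys" using len by (simp add: split)
    have "ys ! length P \<in> set W" "ys ! (length P + d - 1) \<in> set W"
      using nth[of 0] nth[of "d - 1"] d len by auto
    then show "int (ys ! length P) - int (ys ! (length P + d - 1)) < 2"
      by (auto dest!: mem)
    have "(\<Sum>t<d. ys ! (length P + t)) = sum_list W"
      unfolding sum_list_sum_nth len by (auto simp: atLeast0LessThan nth intro!: sum.cong)
    also have "\<dots> = sum_mset (balanced d N)"
      by (simp add: W_def balanced_def m_def a_def sum_list_replicate)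
    finally show "(\<Sum>t<d. ys ! (length P + t)) = N" using sum_balanced[OF d] by simp
  qed
qed

text \<open>The part of a balanced window that the partition itself has to supply, the zeros being fictitious.\<close>

definition window_block :: "nat \<Rightarrow> nat \<Rightarrow> nat multiset" where
  "window_block d N = filter_mset (\<lambda>x. 0 < x) (balanced d N)"

text \<open>
  Since \<open>N > 0\<close>, a balanced window has a nonzero entry, hence at most \<open>d - 1\<close> zeros, which are
  always available.
\<close>

lemma window_block_subset_iff:
  assumes "0 < N" "0 < d" "0 \<notin> set xs"
  shows "window_block d N \<subseteq># mset xs \<longleftrightarrow> balanced d N \<subseteq># mset (with_zeros d xs)"
proof -
  have zero: "count (balanced d N) 0 \<le> d - 1"
    using assms(1,2) by (auto simp: balanced_def div_eq_0_iff)
  have "count (mset xs) 0 = 0" using assms(3) by (simp add: count_eq_zero_iff)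
  with zero have "(count (window_block d N) x \<le> count (mset xs) x) =
      (count (balanced d N) x \<le> count (mset (with_zeros d xs)) x)" for x
    by (cases "x = 0") (auto simp: window_block_def with_zeros_def)
  then show ?thesis by (simp add: subseteq_mset_def)
qed

lemma cond_S_iff:
  assumes k: "4 \<le> k" and xs: "xs \<in> partitions_of n"
  shows "cond_S k j xs \<longleftrightarrow>
    (\<forall>N\<in>{N. 0 < N \<and> [N = j] (mod k)}. \<not> window_block ((k + 1) div 2) N \<subseteq># mset xs)"
proof -
  define d where "d = (k + 1) div 2"
  define ys where "ys = with_zeros d xs"
  have d: "nat \<lceil>real k / 2\<rceil> = d" "0 < d"
    using k unfolding d_def by linarith+
  have xs0: "0 \<notin> set xs" using xs by (auto simp: partitions_of_def)
  have ys: "sorted_wrt (\<ge>) ys"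
    using xs by (auto simp: ys_def with_zeros_def partitions_of_def sorted_wrt_append
        sorted_wrt_iff_nth_less[of _ "replicate _ _"])
  have count0: "count (mset ys) 0 = d - 1"
    using xs0 by (simp add: ys_def with_zeros_def count_eq_zero_iff)
  \<comment> \<open>For \<open>j = k\<close> the sum \<open>0\<close> is in the excluded class, but \<open>d - 1\<close> zeros do not fill a window.\<close>
  have "balanced d 0 = replicate_mset d 0" by (simp add: balanced_def)
  then have not0: "\<not> balanced d 0 \<subseteq># mset ys"
    using count0 d(2) by (simp flip: count_le_replicate_mset_subset_eq)
  have "cond_S k j xs \<longleftrightarrow> (\<forall>i. i + d \<le> length ys \<longrightarrow> int (ys ! i) - int (ys ! (i + d - 1)) < 2 \<longrightarrow>
      \<not> [(\<Sum>m<d. ys ! (i + m)) = j] (mod k))"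
    unfolding cond_S_def Let_def d(1) ys_def ..
  also have "\<dots> \<longleftrightarrow> (\<forall>N. [N = j] (mod k) \<longrightarrow> \<not> balanced d N \<subseteq># mset ys)"
    by (metis window_imp_balanced[OF ys d(2)] balanced_imp_window[OF ys d(2)])
  also have "\<dots> \<longleftrightarrow> (\<forall>N. 0 < N \<and> [N = j] (mod k) \<longrightarrow> \<not> balanced d N \<subseteq># mset ys)"
    using not0 by (metis gr0I)
  also have "\<dots> \<longleftrightarrow> (\<forall>N. 0 < N \<and> [N = j] (mod k) \<longrightarrow> \<not> window_block d N \<subseteq># mset xs)"
    using window_block_subset_iff[OF _ d(2) xs0] by (auto simp: ys_def)
  finally show ?thesis by (simp add: d_def)
qed

text \<open>
  The block of \<open>N\<close> uses parts up to \<open>N / d\<close> rounded up, the block of \<open>N'\<close> parts from \<open>N' / d\<close>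
  rounded down. A gap of \<open>2 d - 1\<close> forces the latter to exceed the former, and \<open>2 d - 2\<close> would not:
  for \<open>N = d m + 1\<close> and \<open>N' = N + 2 d - 2\<close> both blocks contain \<open>m + 1\<close> if \<open>d > 1\<close>.
\<close>

lemma window_blocks_disjoint_less:
  assumes d: "0 < d" and k: "2 * d \<le> k + 1" and "N + k \<le> N'"
  shows "set_mset (window_block d N) \<inter> set_mset (window_block d N') = {}"
proof -
  have N: "N + 2 * d \<le> N' + 1" using assms by linarith
  have False if x: "x \<in># balanced d N" "x \<in># balanced d N'" for x
  proof (cases "N mod d = 0")
    case True
    then have "x = N div d" using set_balanced[OF x(1)] by auto
    moreover have "N + d \<le> N'" using N d by linarith
    then have "N div d < N' div d" using d div_le_mono[of "N + d" N' d] by simp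
    ultimately show False using set_balanced[OF x(2)] by auto
  next
    case False
    then have "d * (N div d) + 1 \<le> N" using mult_div_mod_eq[of d N] by linarith
    then have "d * (N div d + 2) \<le> N'" using N by (simp add: algebra_simps)
    then have "N div d + 2 \<le> N' div d" using d by (simp add: less_eq_div_iff_mult_less_eq mult.commute)
    then show False using set_balanced[OF x(1)] set_balanced[OF x(2)] by auto
  qed
  then show ?thesis by (auto simp: window_block_def)
qed

lemma disjoint_window_blocks:
  assumes d: "0 < d" and k: "2 * d \<le> k + 1"
  shows "disjoint_blocks {N. 0 < N \<and> [N = j] (mod k)} (window_block d)"
proof
  have gap: "N + k \<le> N'" if "[N = j] (mod k)" "[N' = j] (mod k)" "N < N'" for N N'
  proof -
    have "k dvd N' - N"
      using that by (metis cong_altdef_nat cong_sym cong_trans less_imp_le)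
    then show ?thesis using that(3) by (auto dest: dvd_imp_le)
  qed
  fix N N' assume "N \<in> {N. 0 < N \<and> [N = j] (mod k)}" "N' \<in> {N. 0 < N \<and> [N = j] (mod k)}" "N \<noteq> N'"
  then show "set_mset (window_block d N) \<inter> set_mset (window_block d N') = {}"
    using window_blocks_disjoint_less[OF d k] gap[of N N'] gap[of N' N]
    by (cases N N' rule: linorder_cases) (auto simp: Int_commute)
next
  fix N
  have "sum_mset (filter_mset (\<lambda>x. 0 < x) W) = sum_mset W" for W :: "nat multiset"
    by (induction W) auto
  then show "sum_mset (window_block d N) = N"
    using sum_balanced[OF d] by (simp add: window_block_def)
qed (auto simp: window_block_def)

section \<open>The product formula\<close>

text \<open>
  Removing one copy of \<open>a\<close> from the partitions that contain it shows that the generating function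
  \<open>F\<close> for parts in \<open>insert a A\<close> exceeds the one for parts in \<open>A\<close> by \<open>X ^ a * F\<close>.
\<close>

lemma mset_gf_insert:
  assumes "0 < a" "a \<notin> A"
  shows "mset_gf (\<lambda>M. set_mset M \<subseteq> insert a A) = mset_gf (\<lambda>M. set_mset M \<subseteq> A) * inverse (1 - fps_X ^ a)"
proof -
  let ?F = "\<lambda>A. mset_gf (\<lambda>M. set_mset M \<subseteq> A)"
  let ?S = "\<lambda>A n. {M \<in> mset_partitions_of n. set_mset M \<subseteq> A}"
  have "?F (insert a A) = ?F A + fps_X ^ a * ?F (insert a A)"
  proof (rule fps_ext)
    fix n
    let ?T = "{M \<in> ?S (insert a A) n. a \<in># M}"
    have "finite (?S A n)" "finite ?T"
      by (auto intro: finite_subset[OF _ finite_mset_partitions_of[of n]])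
    moreover have "?S A n \<inter> ?T = {}" using assms(2) by auto
    ultimately have "card (?S A n \<union> ?T) = card (?S A n) + card ?T"
      by (rule card_Un_disjoint)
    moreover have "?S (insert a A) n = ?S A n \<union> ?T" by auto
    ultimately have "card (?S (insert a A) n) = card (?S A n) + card ?T" by argo
    moreover have "card ?T = (if n < a then 0 else card (?S (insert a A) (n - a)))"
    proof (cases "n < a")
      case True
      then have "?T = {}"
        by (auto simp: mset_partitions_of_def dest!: multi_member_split)
      with True show ?thesis by (simp only: card.empty if_True)
    next
      case False
      have "?T = add_mset a ` ?S (insert a A) (n - a)"
      proof (intro equalityI subsetI)
        fix M assume M: "M \<in> ?T"
        then obtain M' where "M = add_mset a M'" by (auto dest: multi_member_split)
        with M show "M \<in> add_mset a ` ?S (insert a A) (n - a)"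
          by (auto simp: mset_partitions_of_def)
      qed (use False assms(1) in \<open>auto simp: mset_partitions_of_def\<close>)
      with False show ?thesis by (simp add: card_image inj_on_def)
    qed
    ultimately show "fps_nth (?F (insert a A)) n = fps_nth (?F A + fps_X ^ a * ?F (insert a A)) n"
      by (simp add: mset_gf_def fps_X_power_mult_nth)
  qed
  then have *: "?F (insert a A) * (1 - fps_X ^ a) = ?F A" by (simp add: algebra_simps)
  have "fps_nth (1 - fps_X ^ a :: rat fps) 0 \<noteq> 0" using assms(1) by simp
  then have "(1 - fps_X ^ a :: rat fps) * inverse (1 - fps_X ^ a) = 1"
    by (rule inverse_mult_eq_1')
  then show ?thesis by (simp flip: * add: mult.assoc)
qed

lemma mset_gf_has_prod:
  "(\<lambda>m. if Suc m \<in> A then inverse (1 - fps_X ^ Suc m) else 1)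
     has_prod mset_gf (\<lambda>M. set_mset M \<subseteq> A)" (is "?f has_prod _")
proof -
  let ?F = "\<lambda>A. mset_gf (\<lambda>M. set_mset M \<subseteq> A)"
  have partial: "(\<Prod>m<n. ?f m) = ?F (A \<inter> {1..n})" for n
  proof (induction n)
    case 0
    have "{M \<in> mset_partitions_of n. M = {#}} = (if n = 0 then {{#}} else {})" for n
      by (auto simp: mset_partitions_of_def)
    then have "?F {} = 1"
      by (intro fps_ext) (simp add: mset_gf_def)
    then show ?case by simp
  next
    case (Suc n)
    show ?case
    proof (cases "Suc n \<in> A")
      case True
      then have "A \<inter> {1..Suc n} = insert (Suc n) (A \<inter> {1..n})" by auto
      with True show ?thesis
        using mset_gf_insert[of "Suc n" "A \<inter> {1..n}"] Suc.IH by simp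
    next
      case False
      then have "A \<inter> {1..Suc n} = A \<inter> {1..n}" by (auto simp: le_Suc_eq)
      with False show ?thesis using Suc.IH by simp
    qed
  qed
  have coeff: "fps_nth (?F (A \<inter> {1..n})) i = fps_nth (?F A) i" if "i \<le> n" for i n
  proof -
    have "set_mset M \<subseteq> {1..n}" if "M \<in> mset_partitions_of i" for M
    proof
      fix x assume x: "x \<in># M"
      with that have "x \<noteq> 0" "x \<le> i"
        by (auto simp: mset_partitions_of_def dest!: multi_member_split)
      with \<open>i \<le> n\<close> show "x \<in> {1..n}" by simp
    qed
    then have "{M \<in> mset_partitions_of i. set_mset M \<subseteq> A \<inter> {1..n}} =
        {M \<in> mset_partitions_of i. set_mset M \<subseteq> A}" by auto
    then show ?thesis by (simp add: mset_gf_def)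
  qed
  have "(\<lambda>n. \<Prod>m<Suc n. ?f m) \<longlonglongrightarrow> ?F A"
  proof (rule tendsto_fpsI)
    fix i
    show "\<forall>\<^sub>F n in sequentially. fps_nth (\<Prod>m<Suc n. ?f m) i = fps_nth (?F A) i"
      using eventually_ge_at_top[of i]
      by eventually_elim (simp only: partial coeff le_SucI)
  qed
  moreover have "?F A \<noteq> 0" by (rule mset_gf_nonzero) simp
  ultimately have "raw_has_prod ?f 0 (?F A)"
    by (simp only: raw_has_prod_def lessThan_Suc_atMost add_0_right simp_thms)
  then show ?thesis unfolding has_prod_def ..
qed

section \<open>The partition identity\<close>

theorem mainTheorem11:
  fixes k j :: nat
  assumes "k \<ge> 4" and "1 \<le> j" and "j \<le> k"
  shows "(\<forall>n. card {xs \<in> partitions_of n. cond_P k j xs} =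
               card {xs \<in> partitions_of n. cond_S k j xs}) \<and>
         (\<lambda>m. if [Suc m = j] (mod k) then 1 else inverse (1 - fps_X ^ Suc m))
           has_prod gen_fun (cond_P k j)"
proof
  define I where "I = {N. 0 < N \<and> [N = j] (mod k)}"
  define d where "d = (k + 1) div 2"
  let ?P = "\<lambda>M. \<forall>N\<in>I. N \<notin># M"
  let ?S = "\<lambda>M. \<forall>N\<in>I. \<not> window_block d N \<subseteq># M"
  have P: "{xs \<in> partitions_of n. cond_P k j xs} = {xs \<in> partitions_of n. ?P (mset xs)}" for n
    by (auto simp: cond_P_def I_def partitions_of_def)
  have S: "{xs \<in> partitions_of n. cond_S k j xs} = {xs \<in> partitions_of n. ?S (mset xs)}" for n
    using cond_S_iff[OF assms(1)] by (auto simp: I_def d_def)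
  have "disjoint_blocks I (window_block d)"
    unfolding I_def by (rule disjoint_window_blocks) (use assms(1) in \<open>auto simp: d_def\<close>)
  from gf_avoid_blocks[OF this] have gf: "mset_gf ?S = mset_gf ?P" .
  show "\<forall>n. card {xs \<in> partitions_of n. cond_P k j xs} = card {xs \<in> partitions_of n. cond_S k j xs}"
  proof
    fix n
    have "of_nat (card {xs \<in> partitions_of n. cond_P k j xs}) = fps_nth (mset_gf ?P) n"
      unfolding P by (rule card_partitions_conv_mset_gf)
    also have "\<dots> = of_nat (card {xs \<in> partitions_of n. cond_S k j xs})"
      unfolding gf[symmetric] S by (rule card_partitions_conv_mset_gf[symmetric])
    finally show "card {xs \<in> partitions_of n. cond_P k j xs} =
        card {xs \<in> partitions_of n. cond_S k j xs}" by simp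
  qed
  have "gen_fun (cond_P k j) = mset_gf ?P"
    unfolding gen_fun_def P card_partitions_conv_mset_gf[of _ ?P] by (simp add: fps_eq_iff)
  also have "\<dots> = mset_gf (\<lambda>M. set_mset M \<subseteq> - I)"
    by (rule arg_cong[of _ _ mset_gf]) auto
  finally have "(\<lambda>m. if Suc m \<in> - I then inverse (1 - fps_X ^ Suc m) else 1)
      has_prod gen_fun (cond_P k j)"
    using mset_gf_has_prod[of "- I"] by simp
  moreover have "(\<lambda>m. if Suc m \<in> - I then inverse (1 - fps_X ^ Suc m) else 1) =
      (\<lambda>m. if [Suc m = j] (mod k) then 1 else inverse (1 - fps_X ^ Suc m) :: rat fps)"
    by (auto simp: I_def)
  ultimately show "(\<lambda>m. if [Suc m = j] (mod k) then 1 else inverse (1 - fps_X ^ Suc m))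
      has_prod gen_fun (cond_P k j)" by simp
qed

end
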